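(* If $k=1$, the Anderson-Rubin test, which rejects when $AR=S^2>c(1)$, is the uniformly most powerful unbiased test of $H_0:\beta=\beta_0$ against $H_1:\beta\ne\beta_0$, and its power function is $$P_{\beta,\mu}(AR>c(1))=1-G\left(c(1);\frac{(\beta-\beta_0)^2\mu^2}{b_0'\Sigma b_0}\right),$$ where $G(\cdot\,;\delta^2)$ is the noncentral $\chi^2(1)$ distribution function with noncentrality parameter $\delta^2$. Furthermore, the LM and CQLR tests are equivalent to the Anderson-Rubin test, and are also optimal (i.e. uniformly most powerful unbiased).
   Context: Fix $\beta_0\in\mathbb{R}$ and $\alpha\in(0,1)$. For general $k$, $\Sigma$ is a symmetric positive definite $2k\times2k$ matrix; here $k=1$. For $\beta\in\mathbb{R}$ write $a=(\beta,1)'$, $a_0=(\beta_0,1)'$, $b_0=(1,-\beta_0)'$. Define $$C_{\beta_0}=[(b_0'\otimes I_k)\Sigma(b_0\otimes I_k)]^{-1/2},\qquad D_\beta=[(a_0'\otimes I_k)\Sigma^{-1}(a_0\otimes I_k)]^{-1/2}(a_0'\otimes I_k)\Sigma^{-1}(a\otimes I_k).$$ The parameter is $(\beta,\mu)\in\mathbb{R}\times\mathbb{R}^k$. Under $P_{\beta,\mu}$, $S\sim N((\beta-\beta_0)C_{\beta_0}\mu,I_k)$ and $T\sim N(D_\beta\mu,I_k)$ are independent. A test is a measurable $\phi(S,T)\in[0,1]$. It is unbiased at level $\alpha$ if $E_{\beta_0,\mu}\phi\le\alpha$ for all $\mu$ and $E_{\beta,\mu}\phi\ge\alpha$ for all $\beta\ne\beta_0$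 and all $\mu$. An unbiased test is uniformly most powerful unbiased if it maximizes $E_{\beta,\mu}\phi$ among unbiased level-$\alpha$ tests simultaneously for all $(\beta,\mu)$ with $\beta\neq\beta_0$. $c(d)$ is the $1-\alpha$ quantile of the chi-square distribution with $d$ degrees of freedom. For a full column rank matrix $X$, $N_X=X(X'X)^{-1}X'$. Statistics: $AR=S'S$; $LM=S'N_{C_{\beta_0}D_{\beta_0}^{-1}T}S$; and $$QLR=\tfrac12\left(AR-r(T)+\sqrt{(AR-r(T))^2+4\,LM\cdot r(T)}\right),\qquad r(T)=T'T.$$ The LM test rejects when $LM>c(1)$. The CQLR test rejects when $QLR>\kappa(T)$, where $\kappa(t)$ is the $1-\alpha$ quantile of the null conditional distribution of $QLR$ given $T=t$ (i.e. with $S\sim N(0,I_k)$). *)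

theory Defs
  imports "HOL-Probability.Probability"
begin

definition sym_pos_def :: "real^2^2 \<Rightarrow> bool" where
  "sym_pos_def \<Sigma> \<longleftrightarrow> transpose \<Sigma> = \<Sigma> \<and> (\<forall>x. x \<noteq> 0 \<longrightarrow> x \<bullet> (\<Sigma> *v x) > 0)"

(* Everything is written for k = 1: the Kronecker products with I_k disappear, and
   C, D, S, T, mu are real numbers. The same vec_a gives a and a_0. *)

definition vec_a :: "real \<Rightarrow> real^2" where
  "vec_a \<beta> = vector [\<beta>, 1]"

definition vec_b :: "real \<Rightarrow> real^2" where
  "vec_b \<beta> = vector [1, - \<beta>]"

definition C_coef :: "real \<Rightarrow> real^2^2 \<Rightarrow> real" where
  "C_coef \<beta>0 \<Sigma> = (vec_b \<beta>0 \<bullet> (\<Sigma> *v vec_b \<beta>0)) powr (-1/2)"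

definition D_coef :: "real \<Rightarrow> real^2^2 \<Rightarrow> real \<Rightarrow> real" where
  "D_coef \<beta>0 \<Sigma> \<beta> =
     (vec_a \<beta>0 \<bullet> (matrix_inv \<Sigma> *v vec_a \<beta>0)) powr (-1/2)
       * (vec_a \<beta>0 \<bullet> (matrix_inv \<Sigma> *v vec_a \<beta>))"

definition normal_law :: "real \<Rightarrow> real measure" where
  "normal_law m = density lborel (\<lambda>x. ennreal (normal_density m 1 x))"

(* The joint law of the pair (S, T) under the parameter (beta, mu). *)

definition P_law :: "real \<Rightarrow> real^2^2 \<Rightarrow> real \<Rightarrow> real \<Rightarrow> (real \<times> real) measure" where
  "P_law \<beta>0 \<Sigma> \<beta> \<mu> =
     normal_law ((\<beta> - \<beta>0) * C_coef \<beta>0 \<Sigma> * \<mu>) \<Otimes>\<^sub>M normal_law (D_coef \<beta>0 \<Sigma> \<beta> * \<mu>)"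

definition power_fun :: "real \<Rightarrow> real^2^2 \<Rightarrow> (real \<times> real \<Rightarrow> real) \<Rightarrow> real \<Rightarrow> real \<Rightarrow> real" where
  "power_fun \<beta>0 \<Sigma> \<phi> \<beta> \<mu> = (\<integral>x. \<phi> x \<partial>P_law \<beta>0 \<Sigma> \<beta> \<mu>)"

definition is_test :: "(real \<times> real \<Rightarrow> real) \<Rightarrow> bool" where
  "is_test \<phi> \<longleftrightarrow> \<phi> \<in> borel_measurable borel \<and> (\<forall>x. 0 \<le> \<phi> x \<and> \<phi> x \<le> 1)"

definition unbiased_test :: "real \<Rightarrow> real^2^2 \<Rightarrow> real \<Rightarrow> (real \<times> real \<Rightarrow> real) \<Rightarrow> bool" where
  "unbiased_test \<beta>0 \<Sigma> \<alpha> \<phi> \<longleftrightarrow>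
     is_test \<phi> \<and>
     (\<forall>\<mu>. power_fun \<beta>0 \<Sigma> \<phi> \<beta>0 \<mu> \<le> \<alpha>) \<and>
     (\<forall>\<beta> \<mu>. \<beta> \<noteq> \<beta>0 \<longrightarrow> power_fun \<beta>0 \<Sigma> \<phi> \<beta> \<mu> \<ge> \<alpha>)"

definition UMPU :: "real \<Rightarrow> real^2^2 \<Rightarrow> real \<Rightarrow> (real \<times> real \<Rightarrow> real) \<Rightarrow> bool" where
  "UMPU \<beta>0 \<Sigma> \<alpha> \<phi> \<longleftrightarrow>
     unbiased_test \<beta>0 \<Sigma> \<alpha> \<phi> \<and>
     (\<forall>\<psi>. unbiased_test \<beta>0 \<Sigma> \<alpha> \<psi> \<longrightarrow>
        (\<forall>\<beta> \<mu>. \<beta> \<noteq> \<beta>0 \<longrightarrow> power_fun \<beta>0 \<Sigma> \<psi> \<beta> \<mu> \<le> power_fun \<beta>0 \<Sigma> \<phi> \<beta> \<mu>))"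

definition equivalent_tests ::
    "real \<Rightarrow> real^2^2 \<Rightarrow> (real \<times> real \<Rightarrow> real) \<Rightarrow> (real \<times> real \<Rightarrow> real) \<Rightarrow> bool" where
  "equivalent_tests \<beta>0 \<Sigma> \<phi> \<psi> \<longleftrightarrow> (\<forall>\<beta> \<mu>. AE x in P_law \<beta>0 \<Sigma> \<beta> \<mu>. \<phi> x = \<psi> x)"

definition chi_square :: "nat \<Rightarrow> real measure" where
  "chi_square d = distr (\<Pi>\<^sub>M i\<in>{..<d}. normal_law 0) borel (\<lambda>z. \<Sum>i<d. (z i)\<^sup>2)"

(* One degree of freedom: the law of (Z + delta)^2 with Z standard normal; it depends on
   delta only through the noncentrality parameter nc = delta^2. *)

definition noncentral_chi_square1 :: "real \<Rightarrow> real measure" where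
  "noncentral_chi_square1 nc = distr (normal_law 0) borel (\<lambda>z. (z + sqrt nc)\<^sup>2)"

definition G_cdf :: "real \<Rightarrow> real \<Rightarrow> real" where
  "G_cdf x nc = cdf (noncentral_chi_square1 nc) x"

definition quantile :: "real measure \<Rightarrow> real \<Rightarrow> real" where
  "quantile M p = Inf {x. p \<le> cdf M x}"

definition chi_crit :: "real \<Rightarrow> nat \<Rightarrow> real" where
  "chi_crit \<alpha> d = quantile (chi_square d) (1 - \<alpha>)"

(* X (X'X)^(-1) X' for a 1 x 1 matrix X. Full column rank means X nonzero; the totalized
   division gives the value 0 at X = 0. *)

definition N_proj :: "real \<Rightarrow> real" where
  "N_proj X = X * inverse (X * X) * X"

definition AR_stat :: "real \<Rightarrow> real" where
  "AR_stat s = s\<^sup>2"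

definition LM_stat :: "real \<Rightarrow> real^2^2 \<Rightarrow> real \<Rightarrow> real \<Rightarrow> real" where
  "LM_stat \<beta>0 \<Sigma> s t = s * N_proj (C_coef \<beta>0 \<Sigma> * inverse (D_coef \<beta>0 \<Sigma> \<beta>0) * t) * s"

definition r_stat :: "real \<Rightarrow> real" where
  "r_stat t = t\<^sup>2"

(* At t = 0 the term containing LM is multiplied by r = 0, so the totalized value of LM
   does not influence QLR. *)

definition QLR_stat :: "real \<Rightarrow> real^2^2 \<Rightarrow> real \<Rightarrow> real \<Rightarrow> real" where
  "QLR_stat \<beta>0 \<Sigma> s t =
     1/2 * (AR_stat s - r_stat t
       + sqrt ((AR_stat s - r_stat t)\<^sup>2 + 4 * LM_stat \<beta>0 \<Sigma> s t * r_stat t))"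

(* S and T are independent with S standard normal under the null hypothesis, so the null
   conditional law of QLR given T = t is the law of QLR(Z, t) with Z standard normal. *)

definition \<kappa>_crit :: "real \<Rightarrow> real^2^2 \<Rightarrow> real \<Rightarrow> real \<Rightarrow> real" where
  "\<kappa>_crit \<beta>0 \<Sigma> \<alpha> t = quantile (distr (normal_law 0) borel (\<lambda>s. QLR_stat \<beta>0 \<Sigma> s t)) (1 - \<alpha>)"

definition AR_reject :: "real \<Rightarrow> (real \<times> real) set" where
  "AR_reject \<alpha> = {(s, t). AR_stat s > chi_crit \<alpha> 1}"

definition LM_reject :: "real \<Rightarrow> real^2^2 \<Rightarrow> real \<Rightarrow> (real \<times> real) set" where
  "LM_reject \<beta>0 \<Sigma> \<alpha> = {(s, t). LM_stat \<beta>0 \<Sigma> s t > chi_crit \<alpha> 1}"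

definition CQLR_reject :: "real \<Rightarrow> real^2^2 \<Rightarrow> real \<Rightarrow> (real \<times> real) set" where
  "CQLR_reject \<beta>0 \<Sigma> \<alpha> = {(s, t). QLR_stat \<beta>0 \<Sigma> s t > \<kappa>_crit \<beta>0 \<Sigma> \<alpha> t}"

end

theory Submission
  imports Defs
begin

text \<open>
  For \<open>k = 1\<close> the law of \<open>(S, T)\<close> is \<open>N(\<theta>, 1) \<otimes> N(\<tau>, 1)\<close> with
  \<open>\<theta> = (\<beta> - \<beta>\<^sub>0) C \<mu>\<close> and \<open>\<tau> = D\<^sub>\<beta> \<mu>\<close>. Since \<open>D\<^sub>\<beta>\<close> is affine in \<open>\<beta>\<close>, the pair
  \<open>(\<theta>, \<tau>)\<close> runs through all of the plane except for the nonzero points of one line through the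
  origin, and the null hypothesis is \<open>\<theta> = 0\<close>. So \<open>T\<close> carries only the nuisance parameter, and
  the problem at a fixed \<open>\<tau>\<close> is the two-sided test of a normal mean.

  Fix \<open>\<tau>\<close>. Near \<open>\<theta> = 0\<close> the power of a test \<open>\<psi>\<close> is \<open>A + \<theta> B + O(\<theta>\<^sup>2)\<close>, where
  \<open>A = E[\<psi>]\<close> and \<open>B = E[\<psi> S]\<close> under \<open>\<theta> = 0\<close>. Unbiasedness makes \<open>\<theta> = 0\<close> a minimum of the
  power with value \<open>\<alpha>\<close>, hence \<open>A = \<alpha>\<close> and \<open>B = 0\<close> (\<open>unbiased_moments\<close>). The likelihood ratio
  \<open>exp (\<theta> s - \<theta>\<^sup>2/2)\<close> is strictly convex in \<open>s\<close>, so it lies above its chord through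
  \<open>s = \<plusminus>\<surd>c\<close> exactly where \<open>s\<^sup>2 > c\<close> (\<open>tilt_crosses_chord\<close>). The chord integrates to the same
  value against all tests with the two moments \<open>\<alpha>\<close> and \<open>0\<close>, so the test that rejects for
  \<open>s\<^sup>2 > c\<close> has the largest power among them, and is the only one up to null sets
  (\<open>two_sided_optimal\<close>). Both moments are taken under the joint law of \<open>(S, T)\<close>, at one
  \<open>\<tau>\<close> at a time.

  The remaining claims are algebra: the projection in \<open>LM\<close> is the identity on the line, so
  \<open>LM = S\<^sup>2\<close> for \<open>T \<noteq> 0\<close>; and the discriminant in \<open>QLR\<close> is \<open>(S\<^sup>2 + T\<^sup>2)\<^sup>2\<close>, so
  \<open>QLR = S\<^sup>2\<close> and its conditional critical value is the one of \<open>AR\<close>.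
\<close>

section \<open>Gaussian shift laws\<close>

lemma sets_normal_law [simp, measurable_cong]: "sets (normal_law m) = sets borel"
  by (simp add: normal_law_def)

lemma space_normal_law [simp]: "space (normal_law m) = UNIV"
  by (simp add: normal_law_def)

lemma prob_space_normal_law: "prob_space (normal_law m)"
  unfolding normal_law_def by (rule prob_space_normal_density) simp

lemma normal_law_shift: "normal_law m = distr (normal_law 0) borel (\<lambda>z. m + z)"
proof -
  have "normal_law m = density (distr lborel borel ((+) m)) (normal_density m 1)"
    by (simp add: normal_law_def lborel_distr_plus)
  also have "\<dots> = distr (density lborel (\<lambda>z. normal_density m 1 (m + z))) borel ((+) m)"
    by (subst density_distr) auto
  also have "(\<lambda>z. normal_density m 1 (m + z)) = normal_density 0 1"
    by (simp add: normal_density_def fun_eq_iff)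
  finally show ?thesis
    by (simp add: normal_law_def)
qed

lemma normal_law_reflect: "normal_law m = distr (normal_law (- m)) borel uminus"
proof -
  have "normal_law m = density (distr lborel borel uminus) (normal_density m 1)"
    by (simp add: normal_law_def lborel_distr_uminus)
  also have "\<dots> = distr (density lborel (\<lambda>z. normal_density m 1 (- z))) borel uminus"
    by (subst density_distr) auto
  also have "(\<lambda>z. normal_density m 1 (- z)) = normal_density (- m) 1"
    by (simp add: normal_density_def fun_eq_iff power2_eq_square algebra_simps)
  finally show ?thesis
    by (simp add: normal_law_def)
qed

lemma AE_normal_law: "(AE s in normal_law m. P s) \<longleftrightarrow> (AE s in lborel. P s)"
  unfolding normal_law_def by (subst AE_density) (auto simp: normal_density_pos)

lemma normal_law_tilt:
  "normal_law \<theta> = density (normal_law 0) (\<lambda>s. ennreal (exp (\<theta> * s - \<theta>\<^sup>2 / 2)))"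
proof -
  have "normal_density 0 1 s * exp (\<theta> * s - \<theta>\<^sup>2 / 2) = normal_density \<theta> 1 s" for s
    by (simp add: normal_density_def mult_exp_exp power2_eq_square field_simps)
  then show ?thesis
    by (simp add: normal_law_def density_density_eq ennreal_mult' [symmetric])
qed

text \<open>
  By reflection the law of the square depends on the mean only through its absolute value, which
  is what the square root of the noncentrality parameter recovers.
\<close>
lemma noncentral_chi_square1_eq_square_law:
  "noncentral_chi_square1 (m\<^sup>2) = distr (normal_law m) borel (\<lambda>s. s\<^sup>2)"
proof -
  have *: "noncentral_chi_square1 (m\<^sup>2) = distr (normal_law \<bar>m\<bar>) borel (\<lambda>s. s\<^sup>2)"
    unfolding noncentral_chi_square1_def
    by (subst normal_law_shift[of "\<bar>m\<bar>"]) (simp add: distr_distr comp_def add.commute)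
  show ?thesis
  proof (cases "m < 0")
    case True
    have "distr (normal_law m) borel (\<lambda>s. s\<^sup>2) = distr (normal_law (- m)) borel (\<lambda>s. s\<^sup>2)"
      by (subst normal_law_reflect) (simp add: distr_distr comp_def)
    then show ?thesis using * True by simp
  qed (use * in simp)
qed

lemma chi_square_1_eq_square_law: "chi_square 1 = distr (normal_law 0) borel (\<lambda>s. s\<^sup>2)"
proof -
  have "distr (Pi\<^sub>M {..<1::nat} (\<lambda>_. normal_law 0)) (normal_law 0) (\<lambda>z. z 0) = normal_law 0"
    by (rule distr_PiM_component) (auto simp: prob_space_normal_law)
  then have "distr (normal_law 0) borel (\<lambda>s. s\<^sup>2)
      = distr (distr (Pi\<^sub>M {..<1::nat} (\<lambda>_. normal_law 0)) (normal_law 0) (\<lambda>z. z 0)) borel (\<lambda>s. s\<^sup>2)"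
    by simp
  also have "\<dots> = chi_square 1"
    unfolding chi_square_def by (subst distr_distr) (auto simp: comp_def)
  finally show ?thesis ..
qed

section \<open>The critical value\<close>

text \<open>
  Without atoms the distribution function is continuous, so the set in the definition of the
  quantile is closed and its infimum is a point where the level is attained exactly.
\<close>
lemma cdf_quantile:
  assumes "real_distribution M" and atomless: "\<And>x. measure M {x} = 0" and "0 < p" "p < 1"
  shows "cdf M (quantile M p) = p"
proof -
  interpret real_distribution M by fact
  let ?A = "{x. p \<le> cdf M x}"
  have cont: "isCont (cdf M) x" for x
    using atomless by (simp add: isCont_cdf)
  have "eventually (\<lambda>x. p < cdf M x) at_top"
    using cdf_lim_at_top_prob \<open>p < 1\<close> by (rule order_tendstoD)
  then obtain u where u: "p < cdf M u"
    by (auto simp: eventually_at_top_linorder)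
  have "eventually (\<lambda>x. cdf M x < p) at_bot"
    using cdf_lim_at_bot \<open>0 < p\<close> by (rule order_tendstoD)
  then obtain l where l: "cdf M l < p"
    by (auto simp: eventually_at_bot_linorder)
  have "l \<le> u"
    using l u cdf_nondecreasing[of u l] by (cases "l \<le> u") auto
  then obtain x where x: "cdf M x = p"
    using IVT[of "cdf M" l p u] l u cont by auto
  have ne: "?A \<noteq> {}" using x by auto
  have bdd: "bdd_below ?A"
    using l cdf_nondecreasing by (intro bdd_belowI[of _ l]) (smt (verit) mem_Collect_eq)
  have "closed ?A"
    using cont by (intro closed_Collect_le continuous_intros continuous_at_imp_continuous_on) auto
  then have "quantile M p \<in> ?A"
    unfolding quantile_def using ne bdd by (intro closed_contains_Inf) auto
  moreover have "quantile M p \<le> x"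
    unfolding quantile_def using x bdd by (intro cInf_lower) auto
  ultimately show ?thesis
    using cdf_nondecreasing[of "quantile M p" x] x by auto
qed

lemma AE_square_neq: "AE s in lborel. s\<^sup>2 \<noteq> (x::real)"
proof -
  have "{s. s\<^sup>2 = x} \<subseteq> {sqrt x, - sqrt x}"
    by (auto simp: real_sqrt_abs)
  then have "finite {s. s\<^sup>2 = x}" by (rule finite_subset) simp
  then have "AE s in lborel. s \<notin> {s. s\<^sup>2 = x}"
    by (intro AE_not_in finite_imp_null_set_lborel)
  then show ?thesis by simp
qed

lemma null_square_law:
  assumes "0 < \<alpha>" "\<alpha> < 1"
  shows measure_two_sided_null: "measure (normal_law 0) {s. chi_crit \<alpha> 1 < s\<^sup>2} = \<alpha>"
    and chi_crit_pos: "0 < chi_crit \<alpha> 1"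
proof -
  let ?c = "chi_crit \<alpha> 1" and ?N = "normal_law 0"
  interpret N: prob_space ?N by (rule prob_space_normal_law)
  interpret Q: real_distribution "distr ?N borel (\<lambda>s. s\<^sup>2)"
    by (rule N.real_distribution_distr) simp
  have meas: "measure (distr ?N borel (\<lambda>s. s\<^sup>2)) B = measure ?N {s. s\<^sup>2 \<in> B}" if "B \<in> sets borel" for B
    using that by (subst measure_distr) (auto simp: vimage_def)
  have null: "measure ?N {s. s\<^sup>2 = x} = 0" for x :: real
    using AE_square_neq[of x] by (subst N.prob_eq_0) (auto simp: AE_normal_law)
  have "cdf (distr ?N borel (\<lambda>s. s\<^sup>2)) ?c = 1 - \<alpha>"
    unfolding chi_crit_def chi_square_1_eq_square_law
    by (rule cdf_quantile) (use assms null in \<open>auto simp: meas Q.real_distribution_axioms\<close>)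
  then have c: "measure ?N {s. s\<^sup>2 \<le> ?c} = 1 - \<alpha>"
    by (simp add: cdf_def meas)
  have "{s. ?c < s\<^sup>2} = space ?N - {s. s\<^sup>2 \<le> ?c}" by auto
  then show "measure ?N {s. ?c < s\<^sup>2} = \<alpha>"
    using c by (simp only:) (subst N.prob_compl, auto)
  show "0 < ?c"
  proof (rule ccontr)
    assume "\<not> 0 < ?c"
    then have "{s. s\<^sup>2 \<le> ?c} \<subseteq> {s. s\<^sup>2 = 0}"
      by auto (metis dual_order.trans linorder_not_less power2_less_eq_zero_iff)
    then have "measure ?N {s. s\<^sup>2 \<le> ?c} \<le> measure ?N {s. s\<^sup>2 = 0}"
      by (intro N.finite_measure_mono) auto
    then show False using null[of 0] c assms by simp
  qed
qed

section \<open>The experiment as an exponential tilt\<close>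

definition shift_law :: "real \<Rightarrow> real \<Rightarrow> (real \<times> real) measure" where
  "shift_law \<theta> \<tau> = normal_law \<theta> \<Otimes>\<^sub>M normal_law \<tau>"

text \<open>
  The likelihood ratio of \<open>\<theta>\<close> against \<open>0\<close>. It involves only the first coordinate, because
  the second one has the same law under both.
\<close>
definition tilt :: "real \<Rightarrow> real \<times> real \<Rightarrow> real" where
  "tilt \<theta> x = exp (\<theta> * fst x - \<theta>\<^sup>2 / 2)"

lemma tilt_nonneg [simp]: "0 \<le> tilt \<theta> x"
  by (simp add: tilt_def)

lemma measurable_tilt [measurable]: "tilt \<theta> \<in> borel_measurable (borel \<Otimes>\<^sub>M borel)"
  unfolding tilt_def by measurable

lemma sets_shift_law [simp, measurable_cong]: "sets (shift_law \<theta> \<tau>) = sets (borel \<Otimes>\<^sub>M borel)"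
  unfolding shift_law_def by (intro sets_pair_measure_cong sets_normal_law)

lemma space_shift_law [simp]: "space (shift_law \<theta> \<tau>) = UNIV"
  by (simp add: shift_law_def space_pair_measure)

lemma prob_space_shift_law: "prob_space (shift_law \<theta> \<tau>)"
  unfolding shift_law_def
  by (intro prob_space_pair prob_space_normal_law)

lemma distr_fst_shift_law: "distr (shift_law \<theta> \<tau>) borel fst = normal_law \<theta>"
proof -
  interpret prob_space "normal_law \<tau>" by (rule prob_space_normal_law)
  have "distr (shift_law \<theta> \<tau>) borel fst = distr (shift_law \<theta> \<tau>) (normal_law \<theta>) fst"
    by (rule distr_cong) auto
  then show ?thesis
    using distr_pair_fst[of "normal_law \<theta>"] by (simp add: shift_law_def)
qed

lemma shift_law_tilt: "shift_law \<theta> \<tau> = density (shift_law 0 \<tau>) (\<lambda>x. ennreal (tilt \<theta> x))"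
proof -
  let ?g = "\<lambda>s. ennreal (exp (\<theta> * s - \<theta>\<^sup>2 / 2))"
  have 1: "density (normal_law \<tau>) (\<lambda>_. 1) = normal_law \<tau>"
    by (rule density_1)
  interpret prob_space "normal_law \<tau>" by (rule prob_space_normal_law)
  have sf: "sigma_finite_measure (normal_law \<tau>)" ..
  have "shift_law \<theta> \<tau> = density (normal_law 0) ?g \<Otimes>\<^sub>M density (normal_law \<tau>) (\<lambda>_. 1)"
    by (simp only: shift_law_def normal_law_tilt[of \<theta>] 1)
  also have "\<dots> = density (shift_law 0 \<tau>) (\<lambda>(s, t). ?g s * 1)"
    unfolding shift_law_def by (rule pair_measure_density) (use sf 1 in auto)
  finally show ?thesis
    by (simp add: tilt_def case_prod_unfold)
qed

text \<open>
  All the laws have the same null sets, so an almost sure equality of tests that is known at a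
  single parameter holds at every parameter.
\<close>
lemma AE_shift_law:
  "(AE x in shift_law \<theta> \<tau>. Q x) \<longleftrightarrow> (AE x in lborel \<Otimes>\<^sub>M lborel. Q x)"
proof -
  have sf: "sigma_finite_measure (density lborel (\<lambda>t. ennreal (normal_density \<tau> 1 t)))"
    using prob_space_normal_law[of \<tau>]
    by (simp add: normal_law_def prob_space_def finite_measure_def)
  have "shift_law \<theta> \<tau> = density (lborel \<Otimes>\<^sub>M lborel)
      (\<lambda>(s, t). ennreal (normal_density \<theta> 1 s) * ennreal (normal_density \<tau> 1 t))"
    unfolding shift_law_def normal_law_def
    by (rule pair_measure_density) (use sf in \<open>auto simp: lborel.sigma_finite_measure_axioms\<close>)
  then show ?thesis
    by (simp only:) (subst AE_density; simp add: case_prod_unfold normal_density_pos ennreal_mult' [symmetric])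
qed

lemma AE_shift_law_fst:
  assumes "AE s in lborel. Q s"
  shows "AE x in shift_law \<theta> \<tau>. Q (fst x)"
proof -
  have "AE s in normal_law \<theta>. Q s"
    using assms by (simp add: AE_normal_law)
  then have "AE s in distr (shift_law \<theta> \<tau>) borel fst. Q s"
    by (simp only: distr_fst_shift_law)
  then show ?thesis
    by (rule AE_distrD[rotated]) simp
qed

lemma AE_shift_law_snd_nonzero: "AE x in shift_law \<theta> \<tau>. snd x \<noteq> 0"
proof -
  interpret prob_space "normal_law \<tau>" by (rule prob_space_normal_law)
  have "AE t in normal_law \<tau>. t \<noteq> 0"
    by (simp add: AE_normal_law AE_lborel_singleton)
  then have "emeasure (normal_law \<tau>) {0} = 0"
    by (subst (asm) AE_iff_measurable[of "{0}"]) auto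
  then have "emeasure (shift_law \<theta> \<tau>) (UNIV \<times> {0}) = 0"
    unfolding shift_law_def by (subst emeasure_pair_measure_Times) auto
  then show ?thesis
    by (intro AE_I[of _ _ "UNIV \<times> {0}"]) auto
qed

lemma integral_shift_law:
  fixes \<psi> :: "real \<times> real \<Rightarrow> real"
  assumes [measurable]: "\<psi> \<in> borel_measurable (borel \<Otimes>\<^sub>M borel)"
  shows "(\<integral>x. \<psi> x \<partial>shift_law \<theta> \<tau>) = (\<integral>x. tilt \<theta> x * \<psi> x \<partial>shift_law 0 \<tau>)"
  by (subst shift_law_tilt) (simp add: integral_density)

lemma tilt_moments:
  shows integrable_tilt: "integrable (shift_law 0 \<tau>) (tilt \<theta>)"
    and integral_tilt: "(\<integral>x. tilt \<theta> x \<partial>shift_law 0 \<tau>) = 1"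
proof -
  interpret prob_space "shift_law \<theta> \<tau>" by (rule prob_space_shift_law)
  have "integrable (shift_law \<theta> \<tau>) (\<lambda>_. 1::real)" by simp
  then show "integrable (shift_law 0 \<tau>) (tilt \<theta>)"
    by (subst (asm) shift_law_tilt) (simp add: integrable_density)
  show "(\<integral>x. tilt \<theta> x \<partial>shift_law 0 \<tau>) = 1"
    using integral_shift_law[of "\<lambda>_. 1" \<theta> \<tau>] prob_space by simp
qed

lemma fst_moments:
  shows integrable_fst_null: "integrable (shift_law 0 \<tau>) fst"
    and integral_fst_null: "(\<integral>x. fst x \<partial>shift_law 0 \<tau>) = 0"
proof -
  have "integrable (normal_law 0) (\<lambda>s. s)" "(\<integral>s. s \<partial>normal_law 0) = 0"
    using integrable_std_normal_distribution_moment[of 1]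
      integral_std_normal_distribution_moment_odd[of 1]
    by (simp_all add: normal_law_def)
  then have 1: "integrable (distr (shift_law 0 \<tau>) borel fst) (\<lambda>s. s)"
    and 2: "(\<integral>s. s \<partial>distr (shift_law 0 \<tau>) borel fst) = 0"
    by (simp_all only: distr_fst_shift_law)
  show "integrable (shift_law 0 \<tau>) fst"
    using integrable_distr[OF _ 1] by simp
  have "(\<integral>s. s \<partial>distr (shift_law 0 \<tau>) borel fst) = (\<integral>x. fst x \<partial>shift_law 0 \<tau>)"
    by (rule integral_distr) simp_all
  with 2 show "(\<integral>x. fst x \<partial>shift_law 0 \<tau>) = 0"
    by simp
qed

lemma is_testD:
  assumes "is_test \<psi>"
  shows "\<psi> \<in> borel_measurable (borel \<Otimes>\<^sub>M borel)" "0 \<le> \<psi> x" "\<psi> x \<le> 1"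
  using assms unfolding is_test_def borel_prod by blast+

lemma integrable_test_mult:
  assumes "is_test \<psi>" and f: "integrable (shift_law 0 \<tau>) f"
  shows "integrable (shift_law 0 \<tau>) (\<lambda>x. \<psi> x * f x)"
proof (rule Bochner_Integration.integrable_bound[OF f])
  note [measurable] = is_testD(1)[OF assms(1)]
  have [measurable]: "f \<in> borel_measurable (shift_law 0 \<tau>)" using f by auto
  show "(\<lambda>x. \<psi> x * f x) \<in> borel_measurable (shift_law 0 \<tau>)" by measurable
  show "AE x in shift_law 0 \<tau>. norm (\<psi> x * f x) \<le> norm (f x)"
    using is_testD(2,3)[OF assms(1)] by (auto simp: abs_mult intro!: mult_left_le_one_le)
qed

lemma integrable_test:
  assumes "is_test \<psi>"
  shows "integrable (shift_law 0 \<tau>) \<psi>"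
proof -
  interpret prob_space "shift_law 0 \<tau>" by (rule prob_space_shift_law)
  show ?thesis
    using integrable_test_mult[OF assms, of \<tau> "\<lambda>_. 1"] by simp
qed

section \<open>Unbiasedness as two moment conditions\<close>

text \<open>
  A quadratic upper bound for the power with the same value and slope at \<open>\<theta> = 0\<close>, in place of
  differentiation under the integral sign. The remainder
  \<open>exp (\<theta> s - \<theta>\<^sup>2/2) - 1 - \<theta> s + \<theta>\<^sup>2/2\<close> is nonnegative because \<open>exp u \<ge> 1 + u\<close>, and its
  expectation is exactly \<open>\<theta>\<^sup>2/2\<close>; a test with values in \<open>[0, 1]\<close> can only decrease it.
\<close>
lemma power_expansion:
  assumes "is_test \<psi>"
  defines "A \<equiv> \<lambda>\<tau>. \<integral>x. \<psi> x \<partial>shift_law 0 \<tau>" and "B \<equiv> \<lambda>\<tau>. \<integral>x. \<psi> x * fst x \<partial>shift_law 0 \<tau>"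
  shows "(\<integral>x. \<psi> x \<partial>shift_law \<theta> \<tau>) \<le> A \<tau> + \<theta> * B \<tau> + \<theta>\<^sup>2 / 2"
proof -
  let ?M = "shift_law 0 \<tau>"
  interpret prob_space ?M by (rule prob_space_shift_law)
  let ?k = "\<lambda>x. tilt \<theta> x - 1 - \<theta> * fst x + \<theta>\<^sup>2 / 2"
  have k: "0 \<le> ?k x" for x
    using exp_ge_add_one_self[of "\<theta> * fst x - \<theta>\<^sup>2 / 2"] unfolding tilt_def by linarith
  note [simp] = integrable_tilt integrable_fst_null
  have kint: "integrable ?M ?k" by simp
  have 1: "integrable ?M \<psi>" "integrable ?M (\<lambda>x. \<psi> x * fst x)" "integrable ?M (\<lambda>x. \<psi> x * tilt \<theta> x)"
    by (intro integrable_test integrable_test_mult assms integrable_fst_null integrable_tilt)+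
  have pointwise: "\<psi> x * tilt \<theta> x \<le> \<psi> x + \<theta> * (\<psi> x * fst x) + ?k x" for x
  proof -
    have "\<psi> x * ?k x \<le> ?k x" "0 \<le> \<psi> x * (\<theta>\<^sup>2 / 2)"
      using mult_left_le_one_le[OF k is_testD(2,3)[OF assms(1)]] is_testD(2)[OF assms(1)]
      by simp_all
    then show ?thesis by (simp add: algebra_simps)
  qed
  have "(\<integral>x. \<psi> x \<partial>shift_law \<theta> \<tau>) = (\<integral>x. \<psi> x * tilt \<theta> x \<partial>?M)"
    by (subst integral_shift_law[OF is_testD(1)[OF assms(1)]]) (simp only: mult.commute)
  also have "\<dots> \<le> (\<integral>x. \<psi> x + \<theta> * (\<psi> x * fst x) + ?k x \<partial>?M)"
    using 1 kint pointwise by (intro integral_mono) auto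
  also have "\<dots> = A \<tau> + \<theta> * B \<tau> + (\<integral>x. ?k x \<partial>?M)"
  proof -
    define h where "h x = ?k x" for x
    have "integrable ?M h" using kint unfolding h_def .
    then show ?thesis
      unfolding A_def B_def h_def[symmetric] using 1(1,2)
      by (simp only: integrable_mult_right
        Bochner_Integration.integrable_add Bochner_Integration.integral_add integral_mult_right_zero)
  qed
  also have "(\<integral>x. ?k x \<partial>?M) = \<theta>\<^sup>2 / 2"
    using prob_space by (simp add: integral_tilt integral_fst_null)
  finally show ?thesis .
qed

text \<open>
  Letting \<open>\<theta> \<rightarrow> 0\<close> in the expansion gives \<open>A \<ge> \<alpha>\<close>. Then \<open>\<theta> (B + \<theta>/2) \<ge> 0\<close> for small
  \<open>\<theta>\<close> of either sign, and dividing by \<open>\<theta>\<close> from the right and from the left forces \<open>B = 0\<close>.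
\<close>
lemma unbiased_moments:
  assumes "is_test \<psi>" and size: "(\<integral>x. \<psi> x \<partial>shift_law 0 \<tau>) \<le> \<alpha>"
    and power: "eventually (\<lambda>\<theta>. \<alpha> \<le> (\<integral>x. \<psi> x \<partial>shift_law \<theta> \<tau>)) (at 0)"
  shows "(\<integral>x. \<psi> x \<partial>shift_law 0 \<tau>) = \<alpha>" and "(\<integral>x. \<psi> x * fst x \<partial>shift_law 0 \<tau>) = 0"
proof -
  define A B where "A = (\<integral>x. \<psi> x \<partial>shift_law 0 \<tau>)" and "B = (\<integral>x. \<psi> x * fst x \<partial>shift_law 0 \<tau>)"
  have bound: "eventually (\<lambda>\<theta>. \<alpha> \<le> A + \<theta> * B + \<theta>\<^sup>2 / 2) (at 0)"
    using power by eventually_elim (use power_expansion[OF assms(1)] in \<open>auto simp: A_def B_def intro: order_trans\<close>)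
  have "((\<lambda>\<theta>. A + \<theta> * B + \<theta>\<^sup>2 / 2) \<longlongrightarrow> A + 0 * B + 0\<^sup>2 / 2) (at 0)"
    by (intro tendsto_intros) auto
  then have "\<alpha> \<le> A"
    by (intro tendsto_lowerbound[OF _ bound]) auto
  then show A: "(\<integral>x. \<psi> x \<partial>shift_law 0 \<tau>) = \<alpha>"
    using size by (simp add: A_def)
  from bound have ev: "eventually (\<lambda>\<theta>. 0 \<le> \<theta> * (B + \<theta> / 2)) (at 0)"
    by eventually_elim (use A in \<open>auto simp: A_def power2_eq_square algebra_simps\<close>)
  have lim: "((\<lambda>\<theta>. B + \<theta> / 2) \<longlongrightarrow> B + 0 / 2) (at 0 within S)" for S
    by (intro tendsto_intros) auto
  have "eventually (\<lambda>\<theta>. 0 \<le> B + \<theta> / 2) (at_right 0)"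
    using filter_leD[OF at_le[OF subset_UNIV] ev] eventually_at_right_less[of "0::real"]
    by eventually_elim (auto simp: zero_le_mult_iff)
  then have "0 \<le> B"
    using tendsto_lowerbound[OF lim] by fastforce
  moreover have "eventually (\<lambda>\<theta>. B + \<theta> / 2 \<le> 0) (at_left 0)"
    using filter_leD[OF at_le[OF subset_UNIV] ev] eventually_at_left_real[of "-1" "0::real", simplified]
    by eventually_elim (auto simp: zero_le_mult_iff)
  then have "B \<le> 0"
    using tendsto_upperbound[OF lim] by fastforce
  ultimately show "(\<integral>x. \<psi> x * fst x \<partial>shift_law 0 \<tau>) = 0"
    by (simp add: B_def)
qed

section \<open>The two-sided Neyman-Pearson inequality\<close>

text \<open>
  The strict tangent inequality at \<open>y\<close>, applied at \<open>x\<close> and at \<open>z\<close>; the slopes cancel in the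
  convex combination.
\<close>
lemma exp_strictly_convex:
  fixes x y z :: real
  assumes "x < y" "y < z" "\<theta> \<noteq> 0"
  defines "g \<equiv> \<lambda>s. exp (\<theta> * s - \<theta>\<^sup>2 / 2)"
  shows "g y * (z - x) < g x * (z - y) + g z * (y - x)"
proof -
  have tangent: "g y * (1 + \<theta> * (w - y)) < g w" if "w \<noteq> y" for w
  proof -
    have "g w = g y * exp (\<theta> * (w - y))"
      by (simp add: g_def mult_exp_exp algebra_simps)
    moreover have "1 + \<theta> * (w - y) < exp (\<theta> * (w - y))"
      using that \<open>\<theta> \<noteq> 0\<close> exp_minus_greater[of "- (\<theta> * (w - y))"] by simp
    ultimately show ?thesis by (simp add: g_def)
  qed
  have "g y * (z - x) = g y * (1 + \<theta> * (x - y)) * (z - y) + g y * (1 + \<theta> * (z - y)) * (y - x)"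
    by (simp add: algebra_simps)
  also have "\<dots> < g x * (z - y) + g z * (y - x)"
    using tangent[of x] tangent[of z] assms(1,2) by (intro add_strict_mono mult_strict_right_mono) auto
  finally show ?thesis .
qed

text \<open>
  The affine function is the chord of the likelihood ratio between \<open>- sqrt c\<close> and \<open>sqrt c\<close>: its
  coefficients play the role of the two multipliers in the generalized Neyman-Pearson lemma.
\<close>
lemma tilt_crosses_chord:
  assumes "\<theta> \<noteq> 0" "0 < c"
  obtains a b where
    "\<And>x. c < (fst x)\<^sup>2 \<Longrightarrow> a + b * fst x < tilt \<theta> x"
    "\<And>x. (fst x)\<^sup>2 < c \<Longrightarrow> tilt \<theta> x < a + b * fst x"
    "\<And>x. (fst x)\<^sup>2 = c \<Longrightarrow> tilt \<theta> x = a + b * fst x"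
proof -
  define r where "r = sqrt c"
  have r: "0 < r" "r\<^sup>2 = c" using assms by (auto simp: r_def)
  define g where "g s = exp (\<theta> * s - \<theta>\<^sup>2 / 2)" for s
  define a b where "a = (g r + g (- r)) / 2" and "b = (g r - g (- r)) / (2 * r)"
  have ab: "g r = a + b * r" "g (- r) = a - b * r"
    using r by (auto simp: a_def b_def field_simps)
  note conv = exp_strictly_convex[OF _ _ assms(1), folded g_def]
  show ?thesis
  proof
    fix x :: "real \<times> real"
    define s where "s = fst x"
    have t: "tilt \<theta> x = g s" by (simp add: tilt_def g_def s_def)
    {
      assume "c < (fst x)\<^sup>2"
      then have "r < \<bar>s\<bar>"
        using r by (metis abs_of_pos power2_abs power2_less_imp_less abs_ge_zero s_def)
      then consider "r < s" | "s < - r" by linarith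
      then have "0 < (2 * r) * (g s - (a + b * s))"
      proof cases
        case 1
        then have "g r * (s - - r) < g (- r) * (s - r) + g s * (r - - r)"
          using r by (intro conv) auto
        then show ?thesis unfolding ab by (simp add: algebra_simps)
      next
        case 2
        then have "g (- r) * (r - s) < g s * (r - - r) + g r * (- r - s)"
          using r by (intro conv) auto
        then show ?thesis unfolding ab by (simp add: algebra_simps)
      qed
      then show "a + b * fst x < tilt \<theta> x"
        using r by (simp add: zero_less_mult_iff t s_def)
    next
      assume "(fst x)\<^sup>2 < c"
      then have "\<bar>s\<bar> < r"
        using r by (metis abs_of_pos power2_abs power2_less_imp_less less_imp_le s_def)
      then have "g s * (r - - r) < g (- r) * (r - s) + g r * (s - - r)"
        using r by (intro conv) auto
      then have "0 < (2 * r) * (a + b * s - g s)"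
        unfolding ab by (simp add: algebra_simps)
      then show "tilt \<theta> x < a + b * fst x"
        using r by (simp add: zero_less_mult_iff t s_def)
    next
      assume "(fst x)\<^sup>2 = c"
      then have "s = r \<or> s = - r"
        using r power2_eq_iff[of s r] by (simp add: s_def)
      then show "tilt \<theta> x = a + b * fst x"
        using ab by (auto simp: t simp flip: s_def)
    }
  qed
qed

definition two_sided :: "real \<Rightarrow> real \<times> real \<Rightarrow> real" where
  "two_sided c = indicator {x. c < (fst x)\<^sup>2}"

lemma is_test_two_sided: "is_test (two_sided c)"
proof -
  have "{x :: real \<times> real. c < (fst x)\<^sup>2} \<in> sets borel"
    by (intro borel_open open_Collect_less continuous_intros)
  then show ?thesis
    by (auto simp: is_test_def two_sided_def split: split_indicator)
qed

lemma integral_two_sided: "(\<integral>x. two_sided c x \<partial>shift_law \<theta> \<tau>) = measure (normal_law \<theta>) {s. c < s\<^sup>2}"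
proof -
  have "measure (normal_law \<theta>) {s. c < s\<^sup>2} = measure (distr (shift_law \<theta> \<tau>) borel fst) {s. c < s\<^sup>2}"
    by (simp only: distr_fst_shift_law)
  also have "\<dots> = measure (shift_law \<theta> \<tau>) {x. c < (fst x)\<^sup>2}"
    by (subst measure_distr) (auto simp: vimage_def)
  finally show ?thesis
    by (simp add: two_sided_def)
qed

text \<open>
  The two-sided test is even in \<open>s\<close> and the null law is symmetric, so the integrand is odd.
\<close>
lemma integral_two_sided_fst: "(\<integral>x. two_sided c x * fst x \<partial>shift_law 0 \<tau>) = 0"
proof -
  let ?h = "\<lambda>s::real. indicator {s. c < s\<^sup>2} s * s :: real"
  have "(\<integral>x. two_sided c x * fst x \<partial>shift_law 0 \<tau>) = (\<integral>s. ?h s \<partial>distr (shift_law 0 \<tau>) borel fst)"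
    by (subst integral_distr) (auto simp: two_sided_def indicator_def)
  then have *: "(\<integral>x. two_sided c x * fst x \<partial>shift_law 0 \<tau>) = (\<integral>s. ?h s \<partial>normal_law 0)"
    by (simp only: distr_fst_shift_law)
  have "(\<integral>s. ?h s \<partial>normal_law 0) = (\<integral>s. ?h s \<partial>distr (normal_law 0) borel uminus)"
    using normal_law_reflect[of 0] by simp
  also have "\<dots> = (\<integral>s. - ?h s \<partial>normal_law 0)"
    by (subst integral_distr) (auto simp: indicator_def)
  finally have **: "(\<integral>s. ?h s \<partial>normal_law 0) = - (\<integral>s. ?h s \<partial>normal_law 0)"
    by simp
  from * ** show ?thesis by linarith
qed

text \<open>
  The product of \<open>\<phi> - \<psi>\<close> with (likelihood ratio minus chord) is pointwise nonnegative, since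
  the sign of the second factor decides whether \<open>\<phi>\<close> is \<open>1\<close> or \<open>0\<close>. Its integral is the
  difference of the two powers, because the chord contributes nothing: \<open>\<phi>\<close> and \<open>\<psi>\<close> have equal
  moments. If the powers agree, the product vanishes almost surely, and the second factor is
  nonzero off the null set \<open>s\<^sup>2 = c\<close>.
\<close>
lemma two_sided_optimal:
  assumes "0 < \<alpha>" "\<alpha> < 1" "is_test \<psi>"
    and size: "(\<integral>x. \<psi> x \<partial>shift_law 0 \<tau>) = \<alpha>" and slope: "(\<integral>x. \<psi> x * fst x \<partial>shift_law 0 \<tau>) = 0"
  defines "\<phi> \<equiv> two_sided (chi_crit \<alpha> 1)"
  shows two_sided_most_powerful: "(\<integral>x. \<psi> x \<partial>shift_law \<theta> \<tau>) \<le> (\<integral>x. \<phi> x \<partial>shift_law \<theta> \<tau>)"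
    and two_sided_unique: "\<theta> \<noteq> 0 \<Longrightarrow> (\<integral>x. \<psi> x \<partial>shift_law \<theta> \<tau>) = (\<integral>x. \<phi> x \<partial>shift_law \<theta> \<tau>) \<Longrightarrow>
      AE x in shift_law 0 \<tau>. \<psi> x = \<phi> x"
proof -
  let ?M = "shift_law 0 \<tau>" and ?c = "chi_crit \<alpha> 1"
  have \<phi>: "is_test \<phi>" "(\<integral>x. \<phi> x \<partial>?M) = \<alpha>" "(\<integral>x. \<phi> x * fst x \<partial>?M) = 0"
    unfolding \<phi>_def using assms(1,2)
    by (simp_all add: is_test_two_sided integral_two_sided integral_two_sided_fst measure_two_sided_null
        del: One_nat_def)
  have key: "(\<integral>x. \<psi> x \<partial>shift_law \<theta> \<tau>) \<le> (\<integral>x. \<phi> x \<partial>shift_law \<theta> \<tau>) \<and>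
    ((\<integral>x. \<psi> x \<partial>shift_law \<theta> \<tau>) = (\<integral>x. \<phi> x \<partial>shift_law \<theta> \<tau>) \<longrightarrow> (AE x in ?M. \<psi> x = \<phi> x))"
    if nz: "\<theta> \<noteq> 0"
  proof -
    obtain a b where above: "\<And>x. ?c < (fst x)\<^sup>2 \<Longrightarrow> a + b * fst x < tilt \<theta> x"
      and below: "\<And>x. (fst x)\<^sup>2 < ?c \<Longrightarrow> tilt \<theta> x < a + b * fst x"
      and on: "\<And>x. (fst x)\<^sup>2 = ?c \<Longrightarrow> tilt \<theta> x = a + b * fst x"
      using tilt_crosses_chord[OF nz chi_crit_pos[OF assms(1,2)]] by blast
    define h where "h x = (\<phi> x - \<psi> x) * (tilt \<theta> x - (a + b * fst x))" for x
    have int: "integrable ?M f" "integrable ?M (\<lambda>x. f x * fst x)" "integrable ?M (\<lambda>x. f x * tilt \<theta> x)"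
      if "is_test f" for f
      by (intro integrable_test integrable_test_mult that integrable_fst_null integrable_tilt)+
    have tilted: "(\<integral>x. f x \<partial>shift_law \<theta> \<tau>) = (\<integral>x. f x * tilt \<theta> x \<partial>?M)" if "is_test f" for f
      by (subst integral_shift_law[OF is_testD(1)[OF that]]) (simp only: mult.commute)
    have h_eq: "h = (\<lambda>x. (\<phi> x * tilt \<theta> x - \<psi> x * tilt \<theta> x)
        - (a * (\<phi> x - \<psi> x) + b * (\<phi> x * fst x - \<psi> x * fst x)))"
      by (simp add: h_def fun_eq_iff algebra_simps)
    note [simp] = int[OF \<phi>(1)] int[OF assms(3)]
    have h_int: "integrable ?M h"
      unfolding h_eq by simp
    have "(\<integral>x. h x \<partial>?M) = (\<integral>x. \<phi> x \<partial>shift_law \<theta> \<tau>) - (\<integral>x. \<psi> x \<partial>shift_law \<theta> \<tau>)"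
      unfolding h_eq tilted[OF \<phi>(1)] tilted[OF assms(3)] by (simp add: \<phi>(2,3) size slope)
    moreover have h_nonneg: "0 \<le> h x" for x
    proof -
      consider "?c < (fst x)\<^sup>2" | "(fst x)\<^sup>2 < ?c" | "(fst x)\<^sup>2 = ?c" by linarith
      then show ?thesis
      proof cases
        case 1
        then have "\<phi> x = 1" by (simp add: \<phi>_def two_sided_def)
        then show ?thesis using above[OF 1] is_testD(3)[OF assms(3), of x] by (simp add: h_def)
      next
        case 2
        then have "\<phi> x = 0" by (simp add: \<phi>_def two_sided_def)
        then show ?thesis using below[OF 2] is_testD(2)[OF assms(3), of x]
          by (simp add: h_def mult_nonneg_nonpos)
      next
        case 3
        then show ?thesis using on[OF 3] by (simp add: h_def)
      qed
    qed
    moreover have "AE x in ?M. \<psi> x = \<phi> x" if "(\<integral>x. h x \<partial>?M) = 0"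
    proof -
      have h0: "AE x in ?M. h x = 0"
        using that integral_nonneg_eq_0_iff_AE[OF h_int] h_nonneg by simp
      have off: "AE x in ?M. (fst x)\<^sup>2 \<noteq> ?c"
        by (rule AE_shift_law_fst) (rule AE_square_neq)
      have "\<psi> x = \<phi> x" if "h x = 0" "(fst x)\<^sup>2 \<noteq> ?c" for x
      proof -
        have "tilt \<theta> x \<noteq> a + b * fst x"
          using above[of x] below[of x] that(2) by linarith
        then show ?thesis using that(1) by (simp add: h_def)
      qed
      then have "AE x in ?M. h x = 0 \<longrightarrow> (fst x)\<^sup>2 \<noteq> ?c \<longrightarrow> \<psi> x = \<phi> x" by simp
      with h0 off show ?thesis
        by eventually_elim simp
    qed
    ultimately show ?thesis
      using Bochner_Integration.integral_nonneg[of ?M h] by auto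
  qed
  show "(\<integral>x. \<psi> x \<partial>shift_law \<theta> \<tau>) \<le> (\<integral>x. \<phi> x \<partial>shift_law \<theta> \<tau>)"
    using key size \<phi>(2) by (cases "\<theta> = 0") auto
  show "AE x in ?M. \<psi> x = \<phi> x"
    if "\<theta> \<noteq> 0" "(\<integral>x. \<psi> x \<partial>shift_law \<theta> \<tau>) = (\<integral>x. \<phi> x \<partial>shift_law \<theta> \<tau>)"
    using key that by blast
qed

section \<open>The parametrization of the instrumental variables model\<close>

text \<open>
  For the inverse, write \<open>a = \<Sigma> y\<close>; then \<open>a' \<Sigma>\<inverse> a = y' \<Sigma> y\<close>.
\<close>
lemma quadratic_form_pos:
  assumes "sym_pos_def \<Sigma>"
  shows "0 < vec_b \<beta> \<bullet> (\<Sigma> *v vec_b \<beta>)" and "0 < vec_a \<beta> \<bullet> (matrix_inv \<Sigma> *v vec_a \<beta>)"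
proof -
  have pos: "0 < x \<bullet> (\<Sigma> *v x)" if "x \<noteq> 0" for x
    using assms that by (auto simp: sym_pos_def_def)
  have "vec_b \<beta> $ 1 = 1" "vec_a \<beta> $ 2 = 1"
    by (simp_all add: vec_a_def vec_b_def)
  then have nz: "vec_b \<beta> \<noteq> 0" "vec_a \<beta> \<noteq> 0"
    by (metis zero_index zero_neq_one)+
  show "0 < vec_b \<beta> \<bullet> (\<Sigma> *v vec_b \<beta>)"
    using pos nz by blast
  have "inj ((*v) \<Sigma>)"
  proof (rule injI)
    fix x y assume "\<Sigma> *v x = \<Sigma> *v y"
    then have "\<Sigma> *v (x - y) = 0" by (simp add: matrix_vector_mult_diff_distrib)
    then show "x = y" using pos[of "x - y"] by (cases "x - y = 0") auto
  qed
  then have "invertible \<Sigma>"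
    using matrix_left_invertible_injective invertible_left_inverse by blast
  then have inv: "\<Sigma> ** matrix_inv \<Sigma> = mat 1"
    unfolding matrix_inv_def invertible_def by (rule someI2_ex) blast
  define y where "y = matrix_inv \<Sigma> *v vec_a \<beta>"
  have y: "\<Sigma> *v y = vec_a \<beta>"
    by (simp add: y_def matrix_vector_mul_assoc inv)
  then have "y \<noteq> 0" using nz by auto
  from pos[OF this] show "0 < vec_a \<beta> \<bullet> (matrix_inv \<Sigma> *v vec_a \<beta>)"
    by (simp add: y inner_commute flip: y_def)
qed

lemma C_coef_pos:
  assumes "sym_pos_def \<Sigma>"
  shows "0 < C_coef \<beta>0 \<Sigma>"
  using quadratic_form_pos(1)[OF assms, of \<beta>0] by (simp add: C_coef_def)

lemma C_coef_squared:
  assumes "sym_pos_def \<Sigma>"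
  shows "(C_coef \<beta>0 \<Sigma>)\<^sup>2 = 1 / (vec_b \<beta>0 \<bullet> (\<Sigma> *v vec_b \<beta>0))"
  using quadratic_form_pos(1)[OF assms, of \<beta>0]
  by (simp add: C_coef_def power2_eq_square powr_add[symmetric] powr_minus_divide)

lemma D_coef_null_pos:
  assumes "sym_pos_def \<Sigma>"
  shows "0 < D_coef \<beta>0 \<Sigma> \<beta>0"
  using quadratic_form_pos(2)[OF assms, of \<beta>0] by (simp add: D_coef_def)

lemma D_coef_affine:
  obtains e where "\<And>\<beta>. D_coef \<beta>0 \<Sigma> \<beta> = D_coef \<beta>0 \<Sigma> \<beta>0 + (\<beta> - \<beta>0) * e"
proof -
  have "vec_a \<beta> = vec_a \<beta>0 + (\<beta> - \<beta>0) *\<^sub>R axis 1 1" for \<beta>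
    by (auto simp: vec_a_def vec_eq_iff forall_2 axis_def)
  then have "matrix_inv \<Sigma> *v vec_a \<beta>
      = matrix_inv \<Sigma> *v vec_a \<beta>0 + (\<beta> - \<beta>0) *\<^sub>R (matrix_inv \<Sigma> *v axis 1 1)" for \<beta>
    by (metis matrix_vector_right_distrib matrix_vector_mult_scaleR)
  then have affine: "vec_a \<beta>0 \<bullet> (matrix_inv \<Sigma> *v vec_a \<beta>) = vec_a \<beta>0 \<bullet> (matrix_inv \<Sigma> *v vec_a \<beta>0)
      + (\<beta> - \<beta>0) * (vec_a \<beta>0 \<bullet> (matrix_inv \<Sigma> *v axis 1 1))" for \<beta>
    by (metis inner_add_right inner_scaleR_right)
  have "D_coef \<beta>0 \<Sigma> \<beta> = D_coef \<beta>0 \<Sigma> \<beta>0 + (\<beta> - \<beta>0)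
      * ((vec_a \<beta>0 \<bullet> (matrix_inv \<Sigma> *v vec_a \<beta>0)) powr (-1/2)
        * (vec_a \<beta>0 \<bullet> (matrix_inv \<Sigma> *v axis 1 1)))" for \<beta>
    unfolding D_coef_def by (subst affine[of \<beta>]) (simp only: distrib_left mult.left_commute)
  then show ?thesis
    by (rule that)
qed

lemma P_law_eq_shift_law:
  "P_law \<beta>0 \<Sigma> \<beta> \<mu> = shift_law ((\<beta> - \<beta>0) * C_coef \<beta>0 \<Sigma> * \<mu>) (D_coef \<beta>0 \<Sigma> \<beta> * \<mu>)"
  by (simp add: P_law_def shift_law_def)

text \<open>
  Unbiasedness constrains the power only at pairs \<open>(\<theta>, \<tau>)\<close> that come from some \<open>(\<beta>, \<mu>)\<close>.
  For \<open>\<theta> \<noteq> 0\<close> the equations \<open>\<theta> = (\<beta> - \<beta>\<^sub>0) C \<mu>\<close> and \<open>\<tau> = D\<^sub>\<beta> \<mu>\<close> are solvable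
  unless \<open>\<tau> = (e / C) \<theta>\<close>, where \<open>e\<close> is the slope of \<open>D\<^sub>\<beta>\<close>. The given alternative is itself a
  solvable pair with the same \<open>\<tau>\<close>, so at most one \<open>\<theta>\<close> is excluded, and all small
  \<open>\<theta> \<noteq> 0\<close> are available.
\<close>
lemma unbiased_test_moments:
  assumes \<Sigma>: "sym_pos_def \<Sigma>" and unb: "unbiased_test \<beta>0 \<Sigma> \<alpha> \<psi>" and "\<beta> \<noteq> \<beta>0" "\<mu> \<noteq> 0"
  defines "\<tau> \<equiv> D_coef \<beta>0 \<Sigma> \<beta> * \<mu>"
  shows "(\<integral>x. \<psi> x \<partial>shift_law 0 \<tau>) = \<alpha>" and "(\<integral>x. \<psi> x * fst x \<partial>shift_law 0 \<tau>) = 0"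
proof -
  let ?C = "C_coef \<beta>0 \<Sigma>" and ?D = "D_coef \<beta>0 \<Sigma> \<beta>0"
  obtain e where e: "\<And>\<beta>. D_coef \<beta>0 \<Sigma> \<beta> = ?D + (\<beta> - \<beta>0) * e"
    using D_coef_affine[of \<beta>0 \<Sigma>] by blast
  have C: "0 < ?C" and D: "0 < ?D"
    using C_coef_pos[OF \<Sigma>] D_coef_null_pos[OF \<Sigma>] by auto
  have "\<forall>\<mu>. power_fun \<beta>0 \<Sigma> \<psi> \<beta>0 \<mu> \<le> \<alpha>" using unb by (simp add: unbiased_test_def)
  \<comment> \<open>Under the null every value of \<open>\<tau>\<close> is attained, with \<open>\<mu> = \<tau> / D\<close>.\<close>
  then have "power_fun \<beta>0 \<Sigma> \<psi> \<beta>0 (\<tau> / ?D) \<le> \<alpha>" ..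
  then have size: "(\<integral>x. \<psi> x \<partial>shift_law 0 \<tau>) \<le> \<alpha>"
    using D by (simp add: power_fun_def P_law_eq_shift_law)
  have reach: "\<alpha> \<le> (\<integral>x. \<psi> x \<partial>shift_law \<theta> \<tau>)" if "\<theta> \<noteq> 0" "\<tau> - e / ?C * \<theta> \<noteq> 0" for \<theta>
  proof -
    \<comment> \<open>Since \<open>D\<^sub>\<beta> \<mu> = D \<mu> + (e / C) \<theta>\<close>, the second equation determines \<open>\<mu>\<close>, and
      then the first one determines \<open>\<beta>\<close>.\<close>
    define \<mu>' where "\<mu>' = (\<tau> - e / ?C * \<theta>) / ?D"
    define \<beta>' where "\<beta>' = \<beta>0 + \<theta> / (?C * \<mu>')"
    have \<mu>': "\<mu>' \<noteq> 0" using that D by (simp add: \<mu>'_def)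
    then have "\<beta>' \<noteq> \<beta>0" using that C by (simp add: \<beta>'_def)
    then have "\<alpha> \<le> power_fun \<beta>0 \<Sigma> \<psi> \<beta>' \<mu>'" using unb by (simp add: unbiased_test_def)
    moreover have "(\<beta>' - \<beta>0) * ?C * \<mu>' = \<theta>"
      using C \<mu>' by (simp add: \<beta>'_def)
    moreover have "D_coef \<beta>0 \<Sigma> \<beta>' * \<mu>' = \<tau>"
    proof -
      have "D_coef \<beta>0 \<Sigma> \<beta>' * \<mu>' = ?D * \<mu>' + e / ?C * \<theta>"
        unfolding e[of \<beta>'] using C \<mu>' by (simp add: \<beta>'_def field_simps)
      also have "?D * \<mu>' = \<tau> - e / ?C * \<theta>" using D by (simp add: \<mu>'_def)
      finally show ?thesis by simp
    qed
    ultimately show ?thesis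
      by (simp add: power_fun_def P_law_eq_shift_law)
  qed
  have "\<tau> - e / ?C * ((\<beta> - \<beta>0) * ?C * \<mu>) = ?D * \<mu>"
    unfolding \<tau>_def e[of \<beta>] using C by (simp add: field_simps)
  then have nz: "\<tau> \<noteq> e / ?C * ((\<beta> - \<beta>0) * ?C * \<mu>)"
    using D \<open>\<mu> \<noteq> 0\<close> by auto
  have "eventually (\<lambda>\<theta>. \<tau> - e / ?C * \<theta> \<noteq> 0) (at 0)"
  proof (cases "e = 0")
    case True
    then show ?thesis using nz by simp
  next
    case False
    have "eventually (\<lambda>\<theta>. \<theta> \<noteq> \<tau> / (e / ?C)) (at 0)"
      by (rule eventually_neq_at_within)
    then show ?thesis
      by eventually_elim (use False C in \<open>auto simp: field_simps\<close>)
  qed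
  then have "eventually (\<lambda>\<theta>. \<alpha> \<le> (\<integral>x. \<psi> x \<partial>shift_law \<theta> \<tau>)) (at 0)"
    using eventually_neq_at_within[of 0 0 UNIV] by eventually_elim (rule reach)
  then show "(\<integral>x. \<psi> x \<partial>shift_law 0 \<tau>) = \<alpha>" and "(\<integral>x. \<psi> x * fst x \<partial>shift_law 0 \<tau>) = 0"
    using unbiased_moments[OF _ size] unb by (auto simp: unbiased_test_def)
qed

section \<open>Optimality and equivalence\<close>

lemma indicator_AR_reject: "indicator (AR_reject \<alpha>) = two_sided (chi_crit \<alpha> 1)"
  by (auto simp: fun_eq_iff AR_reject_def AR_stat_def two_sided_def indicator_def)

lemma power_two_sided:
  "power_fun \<beta>0 \<Sigma> (two_sided c) \<beta> \<mu>
    = measure (normal_law ((\<beta> - \<beta>0) * C_coef \<beta>0 \<Sigma> * \<mu>)) {s. c < s\<^sup>2}"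
  by (simp add: power_fun_def P_law_eq_shift_law integral_two_sided)

text \<open>
  The constant test \<open>\<alpha>\<close> satisfies both moment conditions, so optimality already implies that the
  Anderson-Rubin test is unbiased. Alternatives with \<open>\<mu> = 0\<close> have the same law as the null, and
  every unbiased test has power at most \<open>\<alpha>\<close> there.
\<close>
lemma UMPU_AR:
  assumes \<Sigma>: "sym_pos_def \<Sigma>" and \<alpha>: "0 < \<alpha>" "\<alpha> < 1"
  shows "UMPU \<beta>0 \<Sigma> \<alpha> (indicator (AR_reject \<alpha>))"
proof -
  let ?\<phi> = "two_sided (chi_crit \<alpha> 1)"
  have null: "power_fun \<beta>0 \<Sigma> ?\<phi> \<beta> \<mu> = \<alpha>" if "\<beta> = \<beta>0 \<or> \<mu> = 0" for \<beta> \<mu>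
  proof -
    have "(\<beta> - \<beta>0) * C_coef \<beta>0 \<Sigma> * \<mu> = 0" using that by auto
    then show ?thesis
      by (simp only: power_two_sided measure_two_sided_null[OF \<alpha>])
  qed
  have "\<alpha> \<le> power_fun \<beta>0 \<Sigma> ?\<phi> \<beta> \<mu>" for \<beta> \<mu>
  proof -
    have "(\<integral>x. \<alpha> \<partial>shift_law \<theta> \<tau>) = \<alpha>" "(\<integral>x. \<alpha> * fst x \<partial>shift_law 0 \<tau>) = 0" for \<theta> \<tau>
      using prob_space.prob_space[OF prob_space_shift_law, of \<theta> \<tau>]
      by (simp_all add: integral_fst_null)
    then show ?thesis
      using two_sided_most_powerful[OF \<alpha>, of "\<lambda>_. \<alpha>"] \<alpha>
      by (simp add: power_fun_def P_law_eq_shift_law is_test_def)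
  qed
  then have unb: "unbiased_test \<beta>0 \<Sigma> \<alpha> ?\<phi>"
    using null by (simp add: unbiased_test_def is_test_two_sided)
  have "power_fun \<beta>0 \<Sigma> \<psi> \<beta> \<mu> \<le> power_fun \<beta>0 \<Sigma> ?\<phi> \<beta> \<mu>"
    if \<psi>: "unbiased_test \<beta>0 \<Sigma> \<alpha> \<psi>" and "\<beta> \<noteq> \<beta>0" for \<psi> \<beta> \<mu>
  proof (cases "\<mu> = 0")
    case True
    have "power_fun \<beta>0 \<Sigma> \<psi> \<beta> 0 = power_fun \<beta>0 \<Sigma> \<psi> \<beta>0 0"
      by (simp add: power_fun_def P_law_eq_shift_law)
    also have "\<dots> \<le> \<alpha>" using \<psi> by (simp add: unbiased_test_def)
    finally show ?thesis using True null by simp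
  next
    case False
    then show ?thesis
      using two_sided_most_powerful[OF \<alpha> _ unbiased_test_moments[OF \<Sigma> \<psi> that(2) False]] \<psi>
      by (simp add: power_fun_def P_law_eq_shift_law unbiased_test_def)
  qed
  then show ?thesis
    using unb by (simp add: UMPU_def indicator_AR_reject)
qed

text \<open>
  Equality of power at one alternative with \<open>\<theta> \<noteq> 0\<close> suffices, since all laws have the same null
  sets; the alternative \<open>\<beta> = \<beta>\<^sub>0 + 1\<close>, \<open>\<mu> = 1\<close> is as good as any.
\<close>
lemma UMPU_unique:
  assumes \<Sigma>: "sym_pos_def \<Sigma>" and \<alpha>: "0 < \<alpha>" "\<alpha> < 1" and \<psi>: "UMPU \<beta>0 \<Sigma> \<alpha> \<psi>"
  shows "equivalent_tests \<beta>0 \<Sigma> \<psi> (indicator (AR_reject \<alpha>))"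
proof -
  let ?\<phi> = "two_sided (chi_crit \<alpha> 1)" and ?\<tau> = "D_coef \<beta>0 \<Sigma> (\<beta>0 + 1) * 1"
  have unb: "unbiased_test \<beta>0 \<Sigma> \<alpha> \<psi>" using \<psi> by (simp add: UMPU_def)
  have "power_fun \<beta>0 \<Sigma> \<psi> (\<beta>0 + 1) 1 = power_fun \<beta>0 \<Sigma> ?\<phi> (\<beta>0 + 1) 1"
    using \<psi> UMPU_AR[OF \<Sigma> \<alpha>, of \<beta>0] unfolding UMPU_def indicator_AR_reject
    by (metis add_cancel_left_right antisym one_neq_zero)
  then have eq: "(\<integral>x. \<psi> x \<partial>shift_law (C_coef \<beta>0 \<Sigma>) ?\<tau>) = (\<integral>x. ?\<phi> x \<partial>shift_law (C_coef \<beta>0 \<Sigma>) ?\<tau>)"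
    by (simp add: power_fun_def P_law_eq_shift_law)
  have "(\<integral>x. \<psi> x \<partial>shift_law 0 ?\<tau>) = \<alpha>" "(\<integral>x. \<psi> x * fst x \<partial>shift_law 0 ?\<tau>) = 0"
    by (rule unbiased_test_moments[OF \<Sigma> unb]; simp)+
  then have "AE x in shift_law 0 ?\<tau>. \<psi> x = ?\<phi> x"
    using two_sided_unique[OF \<alpha> _ _ _ _ eq] unb C_coef_pos[OF \<Sigma>, of \<beta>0]
    by (simp add: unbiased_test_def)
  then show ?thesis
    unfolding equivalent_tests_def P_law_eq_shift_law AE_shift_law indicator_AR_reject by blast
qed

lemma UMPU_cong:
  assumes "UMPU \<beta>0 \<Sigma> \<alpha> \<phi>" "is_test \<psi>" "equivalent_tests \<beta>0 \<Sigma> \<psi> \<phi>"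
  shows "UMPU \<beta>0 \<Sigma> \<alpha> \<psi>"
proof -
  have "is_test \<phi>" using assms(1) by (simp add: UMPU_def unbiased_test_def)
  then have "power_fun \<beta>0 \<Sigma> \<psi> \<beta> \<mu> = power_fun \<beta>0 \<Sigma> \<phi> \<beta> \<mu>" for \<beta> \<mu>
    unfolding power_fun_def using assms(2,3)
    by (intro integral_cong_AE) (auto simp: equivalent_tests_def P_law_eq_shift_law is_testD
        cong: measurable_cong_sets)
  then show ?thesis
    using assms(1,2) by (simp add: UMPU_def unbiased_test_def)
qed

lemma power_AR:
  assumes \<Sigma>: "sym_pos_def \<Sigma>"
  shows "measure (P_law \<beta>0 \<Sigma> \<beta> \<mu>) (AR_reject \<alpha>)
    = 1 - G_cdf (chi_crit \<alpha> 1) ((\<beta> - \<beta>0)\<^sup>2 * \<mu>\<^sup>2 / (vec_b \<beta>0 \<bullet> (\<Sigma> *v vec_b \<beta>0)))"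
proof -
  define m where "m = (\<beta> - \<beta>0) * C_coef \<beta>0 \<Sigma> * \<mu>"
  let ?c = "chi_crit \<alpha> 1" and ?N = "normal_law m"
  interpret prob_space ?N by (rule prob_space_normal_law)
  have "measure (P_law \<beta>0 \<Sigma> \<beta> \<mu>) (AR_reject \<alpha>) = power_fun \<beta>0 \<Sigma> (indicator (AR_reject \<alpha>)) \<beta> \<mu>"
    by (simp add: power_fun_def P_law_eq_shift_law)
  also have "\<dots> = measure ?N {s. ?c < s\<^sup>2}"
    by (simp add: indicator_AR_reject power_two_sided m_def)
  also have "{s. ?c < s\<^sup>2} = space ?N - {s. s\<^sup>2 \<le> ?c}" by auto
  also have "measure ?N \<dots> = 1 - measure ?N {s. s\<^sup>2 \<le> ?c}"
    by (rule prob_compl) simp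
  also have "measure ?N {s. s\<^sup>2 \<le> ?c} = G_cdf ?c (m\<^sup>2)"
    unfolding G_cdf_def cdf_def noncentral_chi_square1_eq_square_law
    by (subst measure_distr) (auto simp: vimage_def)
  also have "m\<^sup>2 = (\<beta> - \<beta>0)\<^sup>2 * \<mu>\<^sup>2 / (vec_b \<beta>0 \<bullet> (\<Sigma> *v vec_b \<beta>0))"
    by (simp add: m_def power_mult_distrib C_coef_squared[OF \<Sigma>])
  finally show ?thesis .
qed

lemma LM_stat_eq:
  assumes "sym_pos_def \<Sigma>"
  shows "LM_stat \<beta>0 \<Sigma> s t = (if t = 0 then 0 else s\<^sup>2)"
proof -
  have "N_proj X = (if X = 0 then 0 else 1)" for X
    by (simp add: N_proj_def field_simps)
  then show ?thesis
    using C_coef_pos[OF assms, of \<beta>0] D_coef_null_pos[OF assms, of \<beta>0]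
    by (simp add: LM_stat_def power2_eq_square)
qed

lemma QLR_stat_eq:
  assumes "sym_pos_def \<Sigma>"
  shows "QLR_stat \<beta>0 \<Sigma> s t = s\<^sup>2"
proof -
  have "(AR_stat s - r_stat t)\<^sup>2 + 4 * LM_stat \<beta>0 \<Sigma> s t * r_stat t = (s\<^sup>2 + t\<^sup>2)\<^sup>2"
    by (simp add: LM_stat_eq[OF assms] AR_stat_def r_stat_def power2_eq_square algebra_simps)
  then show ?thesis
    by (simp add: QLR_stat_def AR_stat_def r_stat_def)
qed

lemma CQLR_reject_eq:
  assumes "sym_pos_def \<Sigma>"
  shows "CQLR_reject \<beta>0 \<Sigma> \<alpha> = AR_reject \<alpha>"
  by (simp add: CQLR_reject_def AR_reject_def AR_stat_def \<kappa>_crit_def chi_crit_def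
      QLR_stat_eq[OF assms] chi_square_1_eq_square_law del: One_nat_def)

text \<open>
  At \<open>t = 0\<close> the LM statistic takes the default value \<open>0\<close>, which lies below the positive critical
  value: the LM test accepts there.
\<close>
lemma LM_reject_eq:
  assumes "sym_pos_def \<Sigma>" "0 < \<alpha>" "\<alpha> < 1"
  shows "LM_reject \<beta>0 \<Sigma> \<alpha> = AR_reject \<alpha> \<inter> {x. snd x \<noteq> 0}"
  using chi_crit_pos[OF assms(2,3)]
  by (auto simp: LM_reject_def AR_reject_def AR_stat_def LM_stat_eq[OF assms(1)] split: if_splits)

theorem proposition5:
  fixes \<beta>0 \<alpha> :: real and \<Sigma> :: "real^2^2"
  assumes "sym_pos_def \<Sigma>" and "0 < \<alpha>" and "\<alpha> < 1"
  shows "UMPU \<beta>0 \<Sigma> \<alpha> (indicator (AR_reject \<alpha>))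
    \<and> (\<forall>\<phi>. UMPU \<beta>0 \<Sigma> \<alpha> \<phi> \<longrightarrow> equivalent_tests \<beta>0 \<Sigma> \<phi> (indicator (AR_reject \<alpha>)))
    \<and> (\<forall>\<beta> \<mu>. measure (P_law \<beta>0 \<Sigma> \<beta> \<mu>) (AR_reject \<alpha>)
          = 1 - G_cdf (chi_crit \<alpha> 1) ((\<beta> - \<beta>0)\<^sup>2 * \<mu>\<^sup>2 / (vec_b \<beta>0 \<bullet> (\<Sigma> *v vec_b \<beta>0))))
    \<and> (\<forall>s t. t \<noteq> 0 \<longrightarrow>
          ((s, t) \<in> LM_reject \<beta>0 \<Sigma> \<alpha> \<longleftrightarrow> (s, t) \<in> AR_reject \<alpha>) \<and>
          ((s, t) \<in> CQLR_reject \<beta>0 \<Sigma> \<alpha> \<longleftrightarrow> (s, t) \<in> AR_reject \<alpha>))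
    \<and> equivalent_tests \<beta>0 \<Sigma> (indicator (LM_reject \<beta>0 \<Sigma> \<alpha>)) (indicator (AR_reject \<alpha>))
    \<and> equivalent_tests \<beta>0 \<Sigma> (indicator (CQLR_reject \<beta>0 \<Sigma> \<alpha>)) (indicator (AR_reject \<alpha>))
    \<and> UMPU \<beta>0 \<Sigma> \<alpha> (indicator (LM_reject \<beta>0 \<Sigma> \<alpha>))
    \<and> UMPU \<beta>0 \<Sigma> \<alpha> (indicator (CQLR_reject \<beta>0 \<Sigma> \<alpha>))"
proof -
  let ?AR = "indicator (AR_reject \<alpha>) :: real \<times> real \<Rightarrow> real"
  let ?LM = "indicator (LM_reject \<beta>0 \<Sigma> \<alpha>) :: real \<times> real \<Rightarrow> real"
  note AR = UMPU_AR[OF assms, of \<beta>0]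
  have "?LM x = ?AR x" if "snd x \<noteq> 0" for x
    using that by (auto simp: LM_reject_eq[OF assms] indicator_def)
  then have equiv: "equivalent_tests \<beta>0 \<Sigma> ?LM ?AR"
    unfolding equivalent_tests_def P_law_eq_shift_law
    by (intro allI eventually_mono[OF AE_shift_law_snd_nonzero])
  have "{x :: real \<times> real. snd x \<noteq> 0} \<in> sets borel"
    by (intro borel_open open_Collect_neq continuous_intros)
  moreover have "AR_reject \<alpha> \<in> sets borel"
    using is_test_two_sided[of "chi_crit \<alpha> 1"]
    unfolding is_test_def indicator_AR_reject[symmetric]
    by (auto simp: borel_measurable_indicator_iff)
  ultimately have "is_test ?LM"
    by (auto simp: is_test_def LM_reject_eq[OF assms] split: split_indicator)
  then have "UMPU \<beta>0 \<Sigma> \<alpha> ?LM"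
    by (rule UMPU_cong[OF AR _ equiv])
  moreover have "equivalent_tests \<beta>0 \<Sigma> ?AR ?AR"
    by (simp add: equivalent_tests_def)
  moreover have "(s, t) \<in> LM_reject \<beta>0 \<Sigma> \<alpha> \<longleftrightarrow> (s, t) \<in> AR_reject \<alpha>" if "t \<noteq> 0" for s t
    using that by (simp add: LM_reject_eq[OF assms])
  ultimately show ?thesis
    unfolding CQLR_reject_eq[OF assms(1)]
    using AR equiv UMPU_unique[OF assms] power_AR[OF assms(1)] by blast
qed

end
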